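(* If $G$ is a $1$-unique graph, then the maximum degree of $G$ is at most $\mathrm{td}(G)-1$; that is, every vertex of $G$ has degree at most $\mathrm{td}(G)-1$.
   Context: Graphs are finite and simple. A $k$-ranking of a graph $G$ is a labeling of $V(G)$ with values from $\{1,\dots,k\}$ such that every path joining two distinct vertices with the same label contains a vertex having a larger label. The tree-depth $\mathrm{td}(G)$ is the smallest $k$ for which $G$ has a $k$-ranking. A ranking of $G$ is optimal if it is a $\mathrm{td}(G)$-ranking. A graph $G$ is $1$-unique if for every vertex $v$ of $G$ there is an optimal ranking of $G$ in which $v$ is the only vertex receiving label $1$. *)

theory Defs
  imports "Graph_Theory.Graph_Theory"
begin

text \<open>
  A finite simple graph is a digraph satisfying the locale predicate \<open>graph\<close> (finite,
  loop-free, without parallel arcs, symmetric): an undirected edge \<open>uv\<close> is the pair of arcs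
  \<open>(u,v)\<close>, \<open>(v,u)\<close>. Hence the degree of \<open>v\<close> is \<open>out_degree G v\<close>; see
  \<open>out_degree_eq_card_neighbours\<close>.

  Labelings are total functions on the vertex type; only the values on \<open>verts G\<close> matter.
\<close>

definition ranking :: "('a, 'b) pre_digraph \<Rightarrow> nat \<Rightarrow> ('a \<Rightarrow> nat) \<Rightarrow> bool" where
  "ranking G k f \<longleftrightarrow>
     f ` verts G \<subseteq> {1..k} \<and>
     (\<forall>u \<in> verts G. \<forall>v \<in> verts G. u \<noteq> v \<and> f u = f v \<longrightarrow>
       (\<forall>p. vpath p G \<and> hd p = u \<and> last p = v \<longrightarrow> (\<exists>w \<in> set p. f w > f u)))"

definition tree_depth :: "('a, 'b) pre_digraph \<Rightarrow> nat" where
  "tree_depth G = (LEAST k. \<exists>f. ranking G k f)"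

definition optimal_ranking :: "('a, 'b) pre_digraph \<Rightarrow> ('a \<Rightarrow> nat) \<Rightarrow> bool" where
  "optimal_ranking G f \<longleftrightarrow> ranking G (tree_depth G) f"

definition one_unique :: "('a, 'b) pre_digraph \<Rightarrow> bool" where
  "one_unique G \<longleftrightarrow>
     (\<forall>v \<in> verts G. \<exists>f. optimal_ranking G f \<and> {u \<in> verts G. f u = 1} = {v})"

text \<open>The set minimised over in \<open>tree_depth\<close> is nonempty.\<close>

lemma (in fin_digraph) ranking_exists: "\<exists>f. ranking G (card (verts G)) f"
proof -
  obtain f where f: "bij_betw f (verts G) {1..card (verts G)}"
    using finite_same_card_bij[of "verts G" "{1..card (verts G)}"] by auto
  then have "ranking G (card (verts G)) f"
    unfolding ranking_def bij_betw_def by (auto dest: inj_onD)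
  then show ?thesis by blast
qed

lemma (in nomulti_digraph) out_degree_eq_card_neighbours:
  "out_degree G v = card {u. v \<rightarrow>\<^bsub>G\<^esub> u}"
proof -
  have "bij_betw (head G) (out_arcs G v) {u. v \<rightarrow>\<^bsub>G\<^esub> u}"
    unfolding bij_betw_def inj_on_def
    by (auto simp: arcs_ends_conv arc_to_ends_def intro: no_multi_arcs)
  then show ?thesis
    unfolding out_degree_def by (rule bij_betw_same_card)
qed

end

theory Submission
  imports Defs
begin

text \<open>
  Fix a vertex \<open>v\<close> and an optimal ranking in which only \<open>v\<close> has label \<open>1\<close>. Two distinct neighbours
  of \<open>v\<close> with a common label would be joined by the path through \<open>v\<close>, whose middle vertex carries
  the smallest label of all and so cannot separate them. Hence the ranking is injective on the
  neighbourhood of \<open>v\<close> and takes values other than \<open>1\<close> there, which leaves room for at most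
  \<open>tree_depth G - 1\<close> neighbours.
\<close>

lemma (in graph) ranking_inj_on_neighbours:
  assumes rank: "ranking G k f" and least: "f v = 1"
  shows "inj_on f {u. v \<rightarrow>\<^bsub>G\<^esub> u}"
proof (rule inj_onI, rule ccontr)
  fix u w
  assume "u \<in> {u. v \<rightarrow>\<^bsub>G\<^esub> u}" "w \<in> {u. v \<rightarrow>\<^bsub>G\<^esub> u}" and eq: "f u = f w" and "u \<noteq> w"
  then have adj: "v \<rightarrow>\<^bsub>G\<^esub> u" "v \<rightarrow>\<^bsub>G\<^esub> w"
    by simp_all
  then have "u \<noteq> v" "w \<noteq> v"
    by (blast dest: adj_not_same)+
  have verts: "u \<in> verts G" "v \<in> verts G" "w \<in> verts G"
    using adj by (blast intro: adj_in_verts)+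
  have "u \<rightarrow>\<^bsub>G\<^esub> v"
    using adj(1) by (rule arcs_ends_symmetric[OF sym_arcs])
  then have "vpath [u, v, w] G"
    using adj(2) verts \<open>u \<noteq> w\<close> \<open>u \<noteq> v\<close> \<open>w \<noteq> v\<close> by (simp add: vpath_def)
  then have "\<exists>x \<in> set [u, v, w]. f x > f u"
    using rank verts \<open>u \<noteq> w\<close> eq unfolding ranking_def
    by (metis last_ConsL last_ConsR list.distinct(1) list.sel(1))
  moreover have "f u \<ge> 1"
    using rank verts unfolding ranking_def by auto
  ultimately show False
    using eq least by auto
qed

theorem mainTheorem6:
  fixes G :: "('a, 'b) pre_digraph"
  assumes "graph G"
    and "one_unique G"
  shows "\<forall>v \<in> verts G. int (out_degree G v) \<le> int (tree_depth G) - 1"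
proof
  fix v assume v: "v \<in> verts G"
  interpret graph G by fact
  obtain f where rank: "ranking G (tree_depth G) f" and unique: "{u \<in> verts G. f u = 1} = {v}"
    using assms(2) v unfolding one_unique_def optimal_ranking_def by blast
  from unique have least: "f v = 1"
    by blast
  have range: "f ` verts G \<subseteq> {1..tree_depth G}"
    using rank unfolding ranking_def by blast
  have "f ` {u. v \<rightarrow>\<^bsub>G\<^esub> u} \<subseteq> {2..tree_depth G}"
  proof (rule image_subsetI)
    fix u assume "u \<in> {u. v \<rightarrow>\<^bsub>G\<^esub> u}"
    then have "u \<in> verts G" "u \<noteq> v"
      by (blast intro: adj_in_verts dest: adj_not_same)+
    then have "f u \<noteq> 1" "f u \<in> {1..tree_depth G}"
      using unique range by auto
    then show "f u \<in> {2..tree_depth G}"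
      by auto
  qed
  from card_inj_on_le[OF ranking_inj_on_neighbours[OF rank least] this]
  have "out_degree G v \<le> tree_depth G - 1"
    by (simp add: out_degree_eq_card_neighbours)
  \<comment> \<open>The label of \<open>v\<close> shows that the truncated subtraction is exact.\<close>
  moreover have "tree_depth G \<ge> 1"
    using range v least by fastforce
  ultimately show "int (out_degree G v) \<le> int (tree_depth G) - 1"
    by linarith
qed

end
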